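(* Let $(\Lambda,d)$ be a row-finite, source-free $k$-graph, and let $v\in\Lambda^0$ be such that both $\Lambda^1v$ and $v\Lambda^1$ are complete edges and $v\neq w$, where $w:=r(\Lambda^1v)$. Then $(\Lambda_R,d_R)$, the graph of $\Lambda$ reduced at $v$, is a row-finite source-free $k$-graph.
   Context: Fix $k\ge1$; $0\in\mathbb{N}$; $e_1,\dots,e_k$ are the standard basis vectors of $\mathbb{N}^k$, and $\mathbb{N}^k$ is regarded as a category with one object, composition being addition. For $n=\sum n_ie_i$, $|n|=\sum n_i$. A $k$-graph is a countable category $\Lambda$ with a functor $d:\Lambda\to\mathbb{N}^k$ satisfying the factorization rule: for every morphism $\lambda$ and $n,m\in\mathbb{N}^k$ with $d(\lambda)=n+m$ there exist unique $\mu,\nu\in\Lambda$ with $d(\mu)=m$, $d(\nu)=n$, $\lambda=\mu\nu$. $\Lambda^n=d^{-1}(n)$; $\Lambda^0$ is the set of vertices (identified with objects); $\Lambda^1=\{\lambda:|d(\lambda)|=1\}$ is the set of edges, an edge in $\Lambda^{e_i}$ having color $e_i$. $r(\lambda),s(\lambda)\in\Lambda^0$ are the unique vertices with $r(\lambda)\lambda s(\lambda)=\lambda$. $v\Lambda^1=\{e\in\Lambda^1:r(e)=v\}$, $\Lambda^1v=\{e\in\Lambda^1:s(e)=v\}$. $\Lambda$ is row-finite if $|\{\lambda\in\Lambda^{e_i}:r(\lambda)=v\}|<\infty$ for all $v\in\Lambda^0$, $1\le i\le k$. A vertex $v$ is a source if $r^{-1}(v)\cap\Lambda^{e_i}=\emptyset$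 for some $i$; $\Lambda$ is source-free if it has no sources. The 1-skeleton of $\Lambda$ is the directed graph $G=(\Lambda^0,\Lambda^1,r,s)$ with edges colored by $d$. For any $k$-colored directed graph, the path category (denoted by $*$, e.g. $G^*$) consists of all finite paths $f_n\cdots f_1$ with $s(f_i)=r(f_{i-1})$, including vertices as paths of length $0$, with range, source and (additively extended) degree. On $G^*$, $\lambda\sim\mu$ means that $\lambda$ and $\mu$ compose to the same morphism of $\Lambda$; thus $\Lambda=G^*/\sim$. A set of edges $E\subseteq\Lambda^1$ is a complete edge if: (1) $E$ contains precisely one edge of each color; (2) $s(e)=s(f)$ and $r(e)=r(f)$ for all $e,f\in E$; (3) if $e\in E$ and $a,b,f\in\Lambda^1$ satisfy $ea\sim fb$ or $ae\sim bf$, then $f\in E$. For such $E$, $r(E)$ denotes the common range of its edges. Reduction at $v$: let $v\in\Lambda^0$ be such that $\Lambda^1v$ and $v\Lambda^1$ are complete edges and $v\ne w:=r(\Lambda^1v)$. Define the $k$-colored graph $G_R=(\Lambda_R^0,\Lambda_R^1,r_R,s_R)$ by $\Lambda_R^0=\Lambda^0\setminus\{v\}$, $\Lambda_R^1=\Lambda^1\setminus\Lambda^1v$, $s_R(e)=s(e)$, and $r_R(e)=r(e)$ if $r(e)\ne v$, $r_R(e)=w$ if $r(e)=v$. Let $\iota:\Lambda_R^0\cup\Lambda_R^1\to\Lambda^0\cup\Lambda^1$ be the inclusion. Fix an edge $f\in\Lambda^1v$ and define $par:G_R^*\to G^*$ by $par(x)=\iota(x)$ for $x\in\Lambda_R^0$;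 for $e\in\Lambda_R^1$, $par(e)=\iota(e)$ if $r(\iota(e))\ne v$ and $par(e)=f\,\iota(e)$ if $r(\iota(e))=v$; and $par(\lambda_n\cdots\lambda_1)=par(\lambda_n)\cdots par(\lambda_1)$. The degree map $d_R$ on $G_R^*$ is determined by $d_R(e)=d(\iota(e))$ for edges. Define $\mu\sim_R\lambda$ on $G_R^*$ if $par(\mu)\sim par(\lambda)$. Then $\Lambda_R=G_R^*/\sim_R$, with composition induced by concatenation and degree map induced by $d_R$, is the graph of $\Lambda$ reduced at $v$. *)

theory Defs
  imports
    "HOL-Library.Countable_Set"
    "HOL-Analysis.Finite_Cartesian_Product"
    "Graph_Theory.Arc_Walk"
begin

section \<open>Higher-rank graphs\<close>

text \<open>
  Small categories are given by their morphisms alone; objects are identified with identity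
  morphisms, and \<open>Rng C x\<close>, \<open>Src C x\<close> are the identity morphisms at the codomain and domain of \<open>x\<close>.
  \<open>Comp C x y\<close> is the composite \<open>x y\<close> (first \<open>y\<close>, then \<open>x\<close>), meaningful only if
  \<open>Src C x = Rng C y\<close>.
\<close>

record 'm category_data =
  Mor :: "'m set"
  Rng :: "'m \<Rightarrow> 'm"
  Src :: "'m \<Rightarrow> 'm"
  Comp :: "'m \<Rightarrow> 'm \<Rightarrow> 'm"

locale small_category =
  fixes C :: "('m, 'z) category_data_scheme"
  assumes Rng_mem: "x \<in> Mor C \<Longrightarrow> Rng C x \<in> Mor C"
    and Src_mem: "x \<in> Mor C \<Longrightarrow> Src C x \<in> Mor C"
    and Rng_Rng: "x \<in> Mor C \<Longrightarrow> Rng C (Rng C x) = Rng C x"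
    and Src_Rng: "x \<in> Mor C \<Longrightarrow> Src C (Rng C x) = Rng C x"
    and Rng_Src: "x \<in> Mor C \<Longrightarrow> Rng C (Src C x) = Src C x"
    and Src_Src: "x \<in> Mor C \<Longrightarrow> Src C (Src C x) = Src C x"
    and Comp_mem: "\<lbrakk>x \<in> Mor C; y \<in> Mor C; Src C x = Rng C y\<rbrakk> \<Longrightarrow> Comp C x y \<in> Mor C"
    and Rng_Comp: "\<lbrakk>x \<in> Mor C; y \<in> Mor C; Src C x = Rng C y\<rbrakk> \<Longrightarrow> Rng C (Comp C x y) = Rng C x"
    and Src_Comp: "\<lbrakk>x \<in> Mor C; y \<in> Mor C; Src C x = Rng C y\<rbrakk> \<Longrightarrow> Src C (Comp C x y) = Src C y"
    and Comp_assoc: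
      "\<lbrakk>x \<in> Mor C; y \<in> Mor C; z \<in> Mor C; Src C x = Rng C y; Src C y = Rng C z\<rbrakk>
        \<Longrightarrow> Comp C (Comp C x y) z = Comp C x (Comp C y z)"
    and Comp_Rng: "x \<in> Mor C \<Longrightarrow> Comp C (Rng C x) x = x"
    and Comp_Src: "x \<in> Mor C \<Longrightarrow> Comp C x (Src C x) = x"

text \<open>
  The monoid \<open>\<nat>\<^sup>k\<close> is \<open>nat ^ 'k\<close> with \<open>k = CARD('k) \<ge> 1\<close>, and \<open>e\<^sub>i\<close> is \<open>axis i 1\<close>.
\<close>

record ('m, 'k::finite) kgraph_data = "'m category_data" +
  Deg :: "'m \<Rightarrow> nat ^ 'k"

locale kgraph = small_category L
  for L :: "('m, 'k::finite) kgraph_data" +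
  assumes countable_Mor: "countable (Mor L)"
    and Deg_identity: "x \<in> Mor L \<Longrightarrow> Rng L x = x \<Longrightarrow> Deg L x = 0"
    and Deg_Comp:
      "\<lbrakk>x \<in> Mor L; y \<in> Mor L; Src L x = Rng L y\<rbrakk> \<Longrightarrow> Deg L (Comp L x y) = Deg L x + Deg L y"
    and factorization:
      "\<lbrakk>x \<in> Mor L; Deg L x = n + m\<rbrakk> \<Longrightarrow>
        \<exists>!(p :: 'm \<times> 'm). case p of (y, z) \<Rightarrow>
          y \<in> Mor L \<and> z \<in> Mor L \<and> Src L y = Rng L z \<and>
          Deg L y = m \<and> Deg L z = n \<and> x = Comp L y z"

definition of_degree :: "('m, 'k::finite) kgraph_data \<Rightarrow> nat ^ 'k \<Rightarrow> 'm set" where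
  "of_degree L n = {x \<in> Mor L. Deg L x = n}"

definition vertices :: "('m, 'k::finite) kgraph_data \<Rightarrow> 'm set" where
  "vertices L = of_degree L 0"

definition edges :: "('m, 'k::finite) kgraph_data \<Rightarrow> 'm set" where
  "edges L = {x \<in> Mor L. (\<Sum>i\<in>UNIV. Deg L x $ i) = 1}"

definition edges_into :: "('m, 'k::finite) kgraph_data \<Rightarrow> 'm \<Rightarrow> 'm set" where
  "edges_into L v = {e \<in> edges L. Rng L e = v}"

definition edges_from :: "('m, 'k::finite) kgraph_data \<Rightarrow> 'm \<Rightarrow> 'm set" where
  "edges_from L v = {e \<in> edges L. Src L e = v}"

definition row_finite :: "('m, 'k::finite) kgraph_data \<Rightarrow> bool" where
  "row_finite L \<longleftrightarrow>
    (\<forall>v\<in>vertices L. \<forall>i. finite {x \<in> of_degree L (axis i 1). Rng L x = v})"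

definition is_source :: "('m, 'k::finite) kgraph_data \<Rightarrow> 'm \<Rightarrow> bool" where
  "is_source L v \<longleftrightarrow> (\<exists>i. {x \<in> of_degree L (axis i 1). Rng L x = v} = {})"

definition source_free :: "('m, 'k::finite) kgraph_data \<Rightarrow> bool" where
  "source_free L \<longleftrightarrow> (\<forall>v\<in>vertices L. \<not> is_source L v)"


section \<open>Coloured digraphs and their path categories\<close>

text \<open>
  In the underlying digraph, \<open>tail\<close> is the source map and \<open>head\<close> is the range map. The colour of
  an edge is recorded as its degree.
\<close>

record ('v, 'e, 'k::finite) colored_digraph =
  graph :: "('v, 'e) pre_digraph"
  color :: "'e \<Rightarrow> nat ^ 'k"

text \<open>
  The path \<open>f\<^sub>n\<cdots>f\<^sub>1\<close> with source \<open>u\<close> is represented by the pair \<open>(u, [f\<^sub>1, \<dots>, f\<^sub>n])\<close>; thus the list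
  is in the reverse of the written order, and \<open>(u, [])\<close> is the vertex \<open>u\<close>.
\<close>

type_synonym ('v, 'e) gpath = "'v \<times> 'e awalk"

definition paths :: "('v, 'e, 'k::finite) colored_digraph \<Rightarrow> ('v, 'e) gpath set" where
  "paths G = {(u, p). \<exists>w. pre_digraph.awalk (graph G) u p w}"

definition path_src :: "('v, 'e) gpath \<Rightarrow> 'v" where
  "path_src p = fst p"

definition path_rng :: "('v, 'e, 'k::finite) colored_digraph \<Rightarrow> ('v, 'e) gpath \<Rightarrow> 'v" where
  "path_rng G p = pre_digraph.awlast (graph G) (fst p) (snd p)"

definition path_comp :: "('v, 'e) gpath \<Rightarrow> ('v, 'e) gpath \<Rightarrow> ('v, 'e) gpath" where
  "path_comp p q = (fst q, snd q @ snd p)"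

definition path_deg :: "('v, 'e, 'k::finite) colored_digraph \<Rightarrow> ('v, 'e) gpath \<Rightarrow> nat ^ 'k" where
  "path_deg G p = sum_list (map (color G) (snd p))"

text \<open>
  The quotient of the path category of \<open>G\<close> by an equivalence relation \<open>R\<close>. Morphisms are the
  \<open>R\<close>-classes. The range, source and composite of classes are the unions of all classes obtained
  from representatives, so each is again a class precisely when the operation does not depend on
  the representatives. The degree is meaningful only if \<open>path_deg G respects R\<close>.
\<close>

definition path_quotient ::
  "('v, 'e, 'k::finite) colored_digraph \<Rightarrow> ('v, 'e) gpath rel \<Rightarrow>
    (('v, 'e) gpath set, 'k) kgraph_data" where
  "path_quotient G R =
    \<lparr> Mor = paths G // R,
      Rng = (\<lambda>X. \<Union>p\<in>X. R `` {(path_rng G p, [])}),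
      Src = (\<lambda>X. \<Union>p\<in>X. R `` {(path_src p, [])}),
      Comp = (\<lambda>X Y. \<Union>p\<in>X. \<Union>q\<in>{q \<in> Y. path_src p = path_rng G q}. R `` {path_comp p q}),
      Deg = (\<lambda>X. the_elem (path_deg G ` X)) \<rparr>"


section \<open>The 1-skeleton and complete edges\<close>

definition skeleton :: "('m, 'k::finite) kgraph_data \<Rightarrow> ('m, 'm, 'k) colored_digraph" where
  "skeleton L =
    \<lparr> graph = \<lparr> verts = vertices L, arcs = edges L, tail = Src L, head = Rng L \<rparr>,
      color = Deg L \<rparr>"

definition path_eval :: "('m, 'k::finite) kgraph_data \<Rightarrow> ('m, 'm) gpath \<Rightarrow> 'm" where
  "path_eval L p = fold (Comp L) (snd p) (fst p)"

definition path_sim :: "('m, 'k::finite) kgraph_data \<Rightarrow> ('m, 'm) gpath rel" where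
  "path_sim L = {(p, q). p \<in> paths (skeleton L) \<and> q \<in> paths (skeleton L) \<and>
                         path_eval L p = path_eval L q}"

definition edge_pair :: "('m, 'k::finite) kgraph_data \<Rightarrow> 'm \<Rightarrow> 'm \<Rightarrow> ('m, 'm) gpath" where
  \<comment> \<open>the path \<open>e a\<close>, first \<open>a\<close> and then \<open>e\<close>; a member of \<open>paths (skeleton L)\<close> only if \<open>s(e) = r(a)\<close>\<close>
  "edge_pair L e a = (Src L a, [a, e])"

definition complete_edge :: "('m, 'k::finite) kgraph_data \<Rightarrow> 'm set \<Rightarrow> bool" where
  "complete_edge L E \<longleftrightarrow>
    E \<subseteq> edges L \<and>
    (\<forall>i. \<exists>!e. e \<in> E \<and> Deg L e = axis i 1) \<and>
    (\<forall>e\<in>E. \<forall>f\<in>E. Src L e = Src L f \<and> Rng L e = Rng L f) \<and>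
    (\<forall>e\<in>E. \<forall>a\<in>edges L. \<forall>b\<in>edges L. \<forall>f\<in>edges L.
      (edge_pair L e a, edge_pair L f b) \<in> path_sim L \<or>
      (edge_pair L a e, edge_pair L b f) \<in> path_sim L \<longrightarrow> f \<in> E)"

definition common_rng :: "('m, 'k::finite) kgraph_data \<Rightarrow> 'm set \<Rightarrow> 'm" where
  "common_rng L E = the_elem (Rng L ` E)"


section \<open>Reduction at a vertex\<close>

definition reduced_digraph ::
  "('m, 'k::finite) kgraph_data \<Rightarrow> 'm \<Rightarrow> ('m, 'm, 'k) colored_digraph" where
  "reduced_digraph L v =
    \<lparr> graph =
        \<lparr> verts = vertices L - {v},
          arcs = edges L - edges_from L v,
          tail = Src L,
          head = (\<lambda>e. if Rng L e = v then common_rng L (edges_from L v) else Rng L e) \<rparr>,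
      color = Deg L \<rparr>"

definition par ::
  "('m, 'k::finite) kgraph_data \<Rightarrow> 'm \<Rightarrow> 'm \<Rightarrow> ('m, 'm) gpath \<Rightarrow> ('m, 'm) gpath" where
  "par L v f p = (fst p, concat (map (\<lambda>e. if Rng L e = v then [e, f] else [e]) (snd p)))"

definition reduced_sim :: "('m, 'k::finite) kgraph_data \<Rightarrow> 'm \<Rightarrow> 'm \<Rightarrow> ('m, 'm) gpath rel" where
  "reduced_sim L v f =
    {(p, q). p \<in> paths (reduced_digraph L v) \<and> q \<in> paths (reduced_digraph L v) \<and>
             (par L v f p, par L v f q) \<in> path_sim L}"

definition reduced_kgraph ::
  "('m, 'k::finite) kgraph_data \<Rightarrow> 'm \<Rightarrow> 'm \<Rightarrow> (('m, 'm) gpath set, 'k) kgraph_data" where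
  "reduced_kgraph L v f = path_quotient (reduced_digraph L v) (reduced_sim L v f)"

end

theory Submission
  imports Defs
begin

text \<open>
  Write \<open>D\<close> for the reduced graph, \<open>E\<close> for the complete edge of all edges with source \<open>v\<close>, and
  \<open>w\<close> for its range. Everything is checked on paths. The quotient of a path category by a
  congruence that respects source, range and degree is a category with a degree functor. If in
  addition every two-edge path is congruent to one with the two colours exchanged, then every
  factorization of the degree of a path is realised: edges of the required colours are moved to
  the source end one at a time (\<open>path_factorization\<close>). What remains for \<open>D\<close> is that the degree is
  well defined, that colours can be exchanged, and that factorizations are unique.

  The closure condition on \<open>E\<close> says that if \<open>b a = b' a'\<close> for edges of \<open>L\<close>, then \<open>s(b) = v\<close>
  iff \<open>s(b') = v\<close> (\<open>square_through_v\<close>). As equivalent paths of the 1-skeleton are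
  connected by such exchanges, the steps at which a path enters \<open>v\<close> depend only on the
  morphism that it represents (\<open>entries_invariant\<close>). Now \<open>par\<close> replaces an edge that
  enters \<open>v\<close> by two edges, the first of which enters \<open>v\<close> and the second, \<open>f\<close>, does not; other
  edges are unchanged. So the Boolean word recording the entries into \<open>v\<close> of a path \<open>p\<close> of \<open>D\<close>
  is encoded in that of \<open>par p\<close> by \<open>True \<mapsto> True False\<close>, \<open>False \<mapsto> False\<close>. This code is injective,
  hence congruent paths of \<open>D\<close> have the same word (\<open>sim_entries\<close>).

  The degrees of \<open>p\<close> and \<open>par p\<close> differ by a multiple of \<open>d(f)\<close> that is read off this word, so the
  degree of a congruence class is well defined. For uniqueness, let \<open>q r\<close> and \<open>q' r'\<close> be
  congruent with \<open>d(r) = d(r')\<close>. Then \<open>r\<close> and \<open>r'\<close> have the same length, and so the same word;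
  thus \<open>par r\<close> and \<open>par r'\<close> have the same degree, and unique factorization in \<open>L\<close> applies.

  Colours of a path \<open>b a\<close> of \<open>D\<close> are exchanged in \<open>L\<close> directly if \<open>a\<close> does not enter \<open>v\<close>. If it
  does, three exchanges turn \<open>b f a\<close> into \<open>b g h\<close>, then \<open>y g' h\<close>, then \<open>y f' x\<close>; the vertex after
  the first edge is always \<open>v\<close>, so \<open>f'\<close> has source \<open>v\<close> and the colour of \<open>f\<close>, whence \<open>f' = f\<close>.
\<close>

section \<open>Paths in a coloured digraph\<close>

lemma path_src_simp [simp]: "path_src (u, p) = u"
  by (simp add: path_src_def)

lemma paths_Nil [simp]: "(u, []) \<in> paths G \<longleftrightarrow> u \<in> verts (graph G)"
  by (auto simp: paths_def pre_digraph.awalk_def pre_digraph.cas.simps)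

lemma path_rng_Nil [simp]: "path_rng G (u, []) = u"
  by (simp add: path_rng_def pre_digraph.awalk_verts.simps)

lemma path_rng_Cons [simp]: "path_rng G (u, e # es) = path_rng G (head (graph G) e, es)"
  by (simp add: path_rng_def pre_digraph.awalk_verts.simps pre_digraph.awalk_verts_non_Nil)

lemma path_deg_Nil [simp]: "path_deg G (u, []) = 0"
  by (simp add: path_deg_def)

lemma path_deg_Cons [simp]: "path_deg G (u, e # es) = color G e + path_deg G (head (graph G) e, es)"
  by (simp add: path_deg_def)

lemma paths_Cons:
  assumes "wf_digraph (graph G)"
  shows "(u, e # es) \<in> paths G \<longleftrightarrow>
    e \<in> arcs (graph G) \<and> tail (graph G) e = u \<and> (head (graph G) e, es) \<in> paths G"
  using assms
  by (auto simp: paths_def pre_digraph.awalk_def pre_digraph.cas.simps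
      wf_digraph.tail_in_verts wf_digraph.head_in_verts)

lemma path_src_comp [simp]: "path_src (path_comp p q) = path_src q"
  by (simp add: path_src_def path_comp_def)

lemma path_deg_comp: "path_deg G (path_comp p q) = path_deg G p + path_deg G q"
  by (simp add: path_deg_def path_comp_def add.commute)

lemma path_comp_assoc: "path_comp (path_comp p q) r = path_comp p (path_comp q r)"
  by (simp add: path_comp_def)

lemma path_rng_append: "path_rng G (u, es @ fs) = path_rng G (path_rng G (u, es), fs)"
  by (induction es arbitrary: u) simp_all

lemma path_rng_comp:
  "path_src p = path_rng G q \<Longrightarrow> path_rng G (path_comp p q) = path_rng G p"
  by (cases p; cases q) (simp add: path_comp_def path_rng_append)

lemma path_src_mem: "p \<in> paths G \<Longrightarrow> path_src p \<in> verts (graph G)"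
  by (cases p) (auto simp: paths_def pre_digraph.awalk_def)

lemma paths_append:
  assumes "wf_digraph (graph G)"
  shows "(u, es @ fs) \<in> paths G \<longleftrightarrow> (u, es) \<in> paths G \<and> (path_rng G (u, es), fs) \<in> paths G"
proof (induction es arbitrary: u)
  case Nil
  show ?case using path_src_mem[of "(u, fs)" G] by auto
next
  case (Cons e es)
  then show ?case by (auto simp: paths_Cons[OF assms])
qed

lemma path_comp_mem:
  assumes "wf_digraph (graph G)" "p \<in> paths G" "q \<in> paths G" "path_src p = path_rng G q"
  shows "path_comp p q \<in> paths G"
  using assms by (cases p; cases q) (simp add: path_comp_def paths_append)

lemma path_rng_mem:
  assumes "wf_digraph (graph G)" "p \<in> paths G"
  shows "path_rng G p \<in> verts (graph G)"
proof -
  obtain u es where p: "p = (u, es)" by (cases p)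
  have "(u, es) \<in> paths G \<Longrightarrow> path_rng G (u, es) \<in> verts (graph G)"
    by (induction es arbitrary: u) (auto simp: paths_Cons[OF assms(1)])
  with assms p show ?thesis by simp
qed

lemma countable_paths:
  assumes "countable (verts (graph G))" "countable (arcs (graph G))"
  shows "countable (paths G)"
proof (rule countable_subset)
  show "paths G \<subseteq> verts (graph G) \<times> lists (arcs (graph G))"
    by (auto simp: paths_def pre_digraph.awalk_def)
  show "countable (verts (graph G) \<times> lists (arcs (graph G)))"
    using assms by (intro countable_SIGMA countable_lists) auto
qed

lemma sum_axis: "(\<Sum>j\<in>UNIV. (axis i c :: nat ^ 'k::finite) $ j) = c"
  by (simp add: axis_def)

lemma vec_nat_split:
  fixes n :: "nat ^ 'k::finite"
  assumes "n $ i > 0"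
  obtains n' where "n = n' + axis i 1"
proof
  show "n = (\<chi> j. n $ j - (axis i 1 :: nat ^ 'k) $ j) + axis i 1"
    using assms by (auto simp: vec_eq_iff axis_def)
qed

lemma vec_nat_sum_eq_0: "(\<Sum>j\<in>UNIV. (n :: nat ^ 'k::finite) $ j) = 0 \<Longrightarrow> n = 0"
  by (simp add: vec_eq_iff)

lemma sum_path_deg:
  assumes wf: "wf_digraph (graph G)"
    and colors: "\<And>e. e \<in> arcs (graph G) \<Longrightarrow> \<exists>i. color G e = axis i 1"
    and p: "p \<in> paths G"
  shows "(\<Sum>i\<in>UNIV. path_deg G p $ i) = length (snd p)"
proof -
  have "(u, es) \<in> paths G \<Longrightarrow> (\<Sum>i\<in>UNIV. path_deg G (u, es) $ i) = length es" for u es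
  proof (induction es arbitrary: u)
    case (Cons e es)
    then have e: "e \<in> arcs (graph G)" "(head (graph G) e, es) \<in> paths G"
      by (auto simp: paths_Cons[OF wf])
    obtain i where "color G e = axis i 1" using colors e by blast
    then show ?case using Cons.IH[OF e(2)] by (simp add: sum.distrib sum_axis)
  qed simp
  with p show ?thesis by (cases p) auto
qed


section \<open>Quotients of path categories\<close>

text \<open>
  A congruence on the path category of a coloured digraph that preserves the degree and allows
  the two colours of each two-edge path to be exchanged. The exchanged path must have the same
  source as the given one; it then has the same range as well, by \<open>sim_rng\<close>.
\<close>

locale path_congruence =
  fixes G :: "('v, 'e, 'k::finite) colored_digraph" and R :: "('v, 'e) gpath rel"
  assumes wf: "wf_digraph (graph G)"
    and colors: "e \<in> arcs (graph G) \<Longrightarrow> \<exists>i. color G e = axis i 1"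
    and equiv: "equiv (paths G) R"
    and sim_src: "(p, q) \<in> R \<Longrightarrow> path_src p = path_src q"
    and sim_rng: "(p, q) \<in> R \<Longrightarrow> path_rng G p = path_rng G q"
    and sim_deg: "(p, q) \<in> R \<Longrightarrow> path_deg G p = path_deg G q"
    and sim_comp:
      "\<lbrakk>(p, p') \<in> R; (q, q') \<in> R; path_src p = path_rng G q\<rbrakk>
        \<Longrightarrow> (path_comp p q, path_comp p' q') \<in> R"
    and swap:
      "\<lbrakk>a \<in> arcs (graph G); b \<in> arcs (graph G); head (graph G) a = tail (graph G) b\<rbrakk> \<Longrightarrow>
        \<exists>a' b'. color G a' = color G b \<and> color G b' = color G a \<and>
          ((tail (graph G) a, [a, b]), (tail (graph G) a, [a', b'])) \<in> R"
begin

abbreviation "Q \<equiv> path_quotient G R"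

lemmas Cons_iff = paths_Cons[OF wf]
lemmas comp_mem = path_comp_mem[OF wf]

lemma sim_mem: "(p, q) \<in> R \<Longrightarrow> p \<in> paths G" "(p, q) \<in> R \<Longrightarrow> q \<in> paths G"
  using equiv by (auto simp: equiv_def refl_on_def)

lemma sim_refl: "p \<in> paths G \<Longrightarrow> (p, p) \<in> R"
  using equiv by (auto simp: equiv_def refl_on_def)

lemma sim_trans [trans]: "(p, q) \<in> R \<Longrightarrow> (q, r) \<in> R \<Longrightarrow> (p, r) \<in> R"
  using equiv by (auto simp: equiv_def dest: transD)

lemma class_eq_iff: "p \<in> paths G \<Longrightarrow> q \<in> paths G \<Longrightarrow> R `` {p} = R `` {q} \<longleftrightarrow> (p, q) \<in> R"
  by (rule eq_equiv_class_iff[OF equiv])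

lemma Mor_iff: "X \<in> Mor Q \<longleftrightarrow> (\<exists>p\<in>paths G. X = R `` {p})"
  by (auto simp: path_quotient_def quotient_def)

lemma class_mem: "p \<in> paths G \<Longrightarrow> R `` {p} \<in> Mor Q"
  by (auto simp: Mor_iff)

lemma UN_class:
  assumes "p \<in> paths G" "\<And>q. (p, q) \<in> R \<Longrightarrow> g q = g p"
  shows "(\<Union>q\<in>R `` {p}. g q) = g p"
proof (rule SUP_eq_const)
  show "R `` {p} \<noteq> {}" using sim_refl[OF assms(1)] by blast
qed (use assms(2) in blast)

lemma Rng_class: "p \<in> paths G \<Longrightarrow> Rng Q (R `` {p}) = R `` {(path_rng G p, [])}"
  unfolding path_quotient_def category_data.simps
  by (rule UN_class) (simp_all add: sim_rng)

lemma Src_class: "p \<in> paths G \<Longrightarrow> Src Q (R `` {p}) = R `` {(path_src p, [])}"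
  unfolding path_quotient_def category_data.simps
  by (rule UN_class) (simp_all add: sim_src)

lemma Deg_class:
  assumes "p \<in> paths G"
  shows "Deg Q (R `` {p}) = path_deg G p"
proof -
  have "path_deg G ` (R `` {p}) = {path_deg G p}"
  proof (intro equalityI subsetI)
    fix n assume "n \<in> path_deg G ` (R `` {p})"
    then obtain q where "(p, q) \<in> R" "n = path_deg G q" by blast
    then show "n \<in> {path_deg G p}" using sim_deg[of p q] by simp
  qed (use sim_refl[OF assms] in blast)
  then show ?thesis by (simp add: path_quotient_def)
qed

lemma Comp_class:
  assumes p: "p \<in> paths G" and q: "q \<in> paths G" and pq: "path_src p = path_rng G q"
  shows "Comp Q (R `` {p}) (R `` {q}) = R `` {path_comp p q}"
proof -
  have *: "R `` {path_comp p' q'} = R `` {path_comp p q}" if "(p, p') \<in> R" "(q, q') \<in> R" for p' q'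
    using equiv_class_eq[OF equiv sim_comp[OF that pq]] by simp
  have **: "(\<Union>q'\<in>{q' \<in> R `` {q}. path_src p' = path_rng G q'}. R `` {path_comp p' q'})
      = R `` {path_comp p q}" if "(p, p') \<in> R" for p'
  proof (intro SUP_eq_const)
    have "q \<in> {q' \<in> R `` {q}. path_src p' = path_rng G q'}"
      using sim_refl[OF q] sim_src[OF that] pq by simp
    then show "{q' \<in> R `` {q}. path_src p' = path_rng G q'} \<noteq> {}" by blast
  qed (use that * in simp)
  have "p \<in> R `` {p}" using sim_refl[OF p] by simp
  then have "R `` {p} \<noteq> {}" by blast
  then show ?thesis
    unfolding path_quotient_def category_data.simps
    by (rule SUP_eq_const) (rule **, simp)
qed

lemma vertex_class_eq_iff:
  "u \<in> verts (graph G) \<Longrightarrow> u' \<in> verts (graph G) \<Longrightarrow> R `` {(u, [])} = R `` {(u', [])} \<longleftrightarrow> u = u'"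
  using sim_src[of "(u, [])" "(u', [])"] by (auto simp: class_eq_iff intro: sim_refl)

lemma composable_iff:
  "p \<in> paths G \<Longrightarrow> q \<in> paths G \<Longrightarrow>
    Src Q (R `` {p}) = Rng Q (R `` {q}) \<longleftrightarrow> path_src p = path_rng G q"
  by (simp add: Src_class Rng_class vertex_class_eq_iff path_src_mem path_rng_mem[OF wf])

lemma small_category_quotient: "small_category Q"
proof
  fix x y z
  assume "x \<in> Mor Q"
  then obtain p where p: "p \<in> paths G" "x = R `` {p}" by (auto simp: Mor_iff)
  have pv: "(path_rng G p, []) \<in> paths G" "(path_src p, []) \<in> paths G"
    using p by (simp_all add: path_src_mem path_rng_mem[OF wf])
  show "Rng Q x \<in> Mor Q" "Src Q x \<in> Mor Q" "Rng Q (Rng Q x) = Rng Q x"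
    "Src Q (Rng Q x) = Rng Q x" "Rng Q (Src Q x) = Src Q x" "Src Q (Src Q x) = Src Q x"
    using p pv by (simp_all add: Rng_class Src_class class_mem)
  show "Comp Q (Rng Q x) x = x" "Comp Q x (Src Q x) = x"
    using p pv by (simp_all add: Rng_class Src_class Comp_class path_comp_def path_src_def)
  assume "y \<in> Mor Q" and xy: "Src Q x = Rng Q y"
  then obtain q where q: "q \<in> paths G" "y = R `` {q}" by (auto simp: Mor_iff)
  have pq: "path_src p = path_rng G q" using xy p q by (simp add: composable_iff)
  note C = comp_mem[OF p(1) q(1) pq]
  show "Comp Q x y \<in> Mor Q" "Rng Q (Comp Q x y) = Rng Q x" "Src Q (Comp Q x y) = Src Q y"
    using p q pq C by (simp_all add: Comp_class class_mem Rng_class Src_class path_rng_comp)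
  assume "z \<in> Mor Q" and yz: "Src Q y = Rng Q z"
  then obtain r where r: "r \<in> paths G" "z = R `` {r}" by (auto simp: Mor_iff)
  have qr: "path_src q = path_rng G r" using yz q r by (simp add: composable_iff)
  note C' = comp_mem[OF q(1) r(1) qr]
  show "Comp Q (Comp Q x y) z = Comp Q x (Comp Q y z)"
    using p q r pq qr C C' by (simp add: Comp_class path_rng_comp path_comp_assoc)
qed

text \<open>
  The edge list of a path starts at the source, so its head is the edge that is traversed first.
\<close>

lemma bring_color_to_source:
  "(u, es) \<in> paths G \<Longrightarrow> path_deg G (u, es) $ i > 0 \<Longrightarrow>
    \<exists>a fs. ((u, es), (u, a # fs)) \<in> R \<and> color G a = axis i 1"
proof (induction es arbitrary: u)
  case (Cons e es)
  let ?h = "head (graph G)"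
  have e: "e \<in> arcs (graph G)" "tail (graph G) e = u" "(?h e, es) \<in> paths G"
    using Cons.prems by (auto simp: Cons_iff)
  obtain j where j: "color G e = axis j 1" using colors e by blast
  show ?case
  proof (cases "j = i")
    case True
    then show ?thesis using j Cons.prems sim_refl by blast
  next
    case False
    then have "path_deg G (?h e, es) $ i > 0"
      using Cons.prems(2) j by (simp add: axis_def)
    from Cons.IH[OF e(3) this] obtain a fs
      where a: "((?h e, es), (?h e, a # fs)) \<in> R" "color G a = axis i 1" by blast
    have a': "a \<in> arcs (graph G)" "tail (graph G) a = ?h e" "(?h a, fs) \<in> paths G"
      using sim_mem(2)[OF a(1)] by (auto simp: Cons_iff)
    have 1: "(u, [e]) \<in> paths G"
      using e path_src_mem[OF e(3)] by (simp add: Cons_iff)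
    have "((u, e # es), (u, e # a # fs)) \<in> R"
      using sim_comp[OF a(1) sim_refl[OF 1]] by (simp add: path_comp_def)
    also obtain a2 b2 where s: "color G a2 = color G a"
      "((u, [e, a]), (u, [a2, b2])) \<in> R"
      using swap[OF e(1) a'(1)] e(2) a'(2) by auto
    have "((u, e # a # fs), (u, a2 # b2 # fs)) \<in> R"
      using sim_comp[OF sim_refl[OF a'(3)] s(2)] by (simp add: path_comp_def)
    finally show ?thesis using s(1) a(2) by auto
  qed
qed simp

lemma path_factorization:
  assumes "p \<in> paths G" "path_deg G p = n + m"
  shows "\<exists>q r. q \<in> paths G \<and> r \<in> paths G \<and> path_src q = path_rng G r \<and>
    path_deg G q = m \<and> path_deg G r = n \<and> (p, path_comp q r) \<in> R"
  using assms
proof (induction "\<Sum>i\<in>UNIV. n $ i" arbitrary: n p)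
  case 0
  then have "n = 0" using vec_nat_sum_eq_0[of n] by simp
  moreover have "path_comp p (path_src p, []) = p"
    by (simp add: path_comp_def path_src_def)
  moreover have "(path_src p, []) \<in> paths G" using 0 by (simp add: path_src_mem)
  ultimately show ?case
    using 0 sim_refl[of p] by (intro exI[of _ p] exI[of _ "(path_src p, [])"]) simp
next
  case (Suc s)
  obtain i where i: "n $ i > 0"
    using Suc(2) by (metis nat.distinct(1) neq0_conv sum.neutral)
  obtain n' where n': "n = n' + axis i 1" using vec_nat_split[OF i] .
  have s: "s = (\<Sum>i\<in>UNIV. n' $ i)"
    using Suc(2) by (simp add: n' sum.distrib sum_axis)
  obtain u es where p: "p = (u, es)" by (cases p)
  have "path_deg G (u, es) $ i > 0" using Suc.prems i p by simp
  with bring_color_to_source Suc.prems(1) p obtain a fs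
    where a: "((u, es), (u, a # fs)) \<in> R" "color G a = axis i 1" by blast
  let ?h = "head (graph G) a"
  have a': "a \<in> arcs (graph G)" "tail (graph G) a = u" "(?h, fs) \<in> paths G"
    using sim_mem(2)[OF a(1)] by (auto simp: Cons_iff)
  have "axis i 1 + path_deg G (?h, fs) = axis i 1 + (n' + m)"
    using sim_deg[OF a(1)] Suc.prems(2) p a(2)
    by (simp add: n' ac_simps)
  then have "path_deg G (?h, fs) = n' + m" by (rule add_left_imp_eq)
  from Suc.hyps(1)[OF s a'(3) this] obtain q r where
    qr: "q \<in> paths G" "r \<in> paths G" "path_src q = path_rng G r"
    "path_deg G q = m" "path_deg G r = n'" "((?h, fs), path_comp q r) \<in> R" by blast
  have 1: "(u, [a]) \<in> paths G"
    using a' path_src_mem[OF a'(3)] by (simp add: Cons_iff)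
  have src: "path_src r = ?h" using sim_src[OF qr(6)] by simp
  have "(path_comp (?h, fs) (u, [a]), path_comp (path_comp q r) (u, [a])) \<in> R"
    by (rule sim_comp[OF qr(6) sim_refl[OF 1]]) simp
  then have "((u, a # fs), path_comp q (path_comp r (u, [a]))) \<in> R"
    by (simp add: path_comp_def)
  then have "(p, path_comp q (path_comp r (u, [a]))) \<in> R"
    using a(1) p sim_trans by blast
  moreover have "path_deg G (path_comp r (u, [a])) = n"
    using qr(5) a(2) n' by (simp add: path_deg_comp )
  moreover have "path_rng G (path_comp r (u, [a])) = path_rng G r"
    using src by (simp add: path_rng_comp)
  moreover have "path_comp r (u, [a]) \<in> paths G"
    using comp_mem[OF qr(2) 1] src by simp
  ultimately show ?case using qr by metis
qed

text \<open>
  Existence of factorizations is automatic for such a congruence; only uniqueness is a further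
  condition.
\<close>

lemma kgraph_quotient:
  assumes "countable (verts (graph G))" "countable (arcs (graph G))"
    and unique: "\<And>q r q' r'. \<lbrakk>q \<in> paths G; r \<in> paths G; path_src q = path_rng G r;
        q' \<in> paths G; r' \<in> paths G; path_src q' = path_rng G r';
        path_deg G q = path_deg G q'; path_deg G r = path_deg G r';
        (path_comp q r, path_comp q' r') \<in> R\<rbrakk> \<Longrightarrow> (q, q') \<in> R \<and> (r, r') \<in> R"
  shows "kgraph Q"
proof -
  interpret small_category Q by (rule small_category_quotient)
  show ?thesis
  proof
    have "Mor Q = (\<lambda>p. R `` {p}) ` paths G" by (auto simp: Mor_iff)
    then show "countable (Mor Q)" using assms by (simp add: countable_paths)
  next
    fix x assume x: "x \<in> Mor Q" "Rng Q x = x"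
    then obtain p where p: "p \<in> paths G" "x = R `` {p}" by (auto simp: Mor_iff)
    then have "((path_rng G p, []), p) \<in> R"
      using x by (simp add: Rng_class class_eq_iff path_rng_mem[OF wf])
    from sim_deg[OF this] show "Deg Q x = 0" using p by (simp add: Deg_class)
  next
    fix x y assume "x \<in> Mor Q" "y \<in> Mor Q" and xy: "Src Q x = Rng Q y"
    then obtain p q where pq: "p \<in> paths G" "x = R `` {p}" "q \<in> paths G" "y = R `` {q}"
      by (auto simp: Mor_iff)
    then have "path_src p = path_rng G q" using xy by (simp add: composable_iff)
    then show "Deg Q (Comp Q x y) = Deg Q x + Deg Q y"
      using pq comp_mem by (simp add: Comp_class Deg_class path_deg_comp)
  next
    fix x n m assume x: "x \<in> Mor Q" "Deg Q x = n + m"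
    then obtain p where p: "p \<in> paths G" "x = R `` {p}" by (auto simp: Mor_iff)
    then have "path_deg G p = n + m" using x by (simp add: Deg_class)
    from path_factorization[OF p(1) this] obtain q r where
      qr: "q \<in> paths G" "r \<in> paths G" "path_src q = path_rng G r"
      "path_deg G q = m" "path_deg G r = n" "(p, path_comp q r) \<in> R" by blast
    have xqr: "x = R `` {path_comp q r}"
      using p qr comp_mem by (simp add: class_eq_iff)
    show "\<exists>!(t :: ('v, 'e) gpath set \<times> ('v, 'e) gpath set). case t of (y, z) \<Rightarrow>
        y \<in> Mor Q \<and> z \<in> Mor Q \<and> Src Q y = Rng Q z \<and>
        Deg Q y = m \<and> Deg Q z = n \<and> x = Comp Q y z"
    proof (rule ex1I[of _ "(R `` {q}, R `` {r})"])
      show "case (R `` {q}, R `` {r}) of (y, z) \<Rightarrow>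
        y \<in> Mor Q \<and> z \<in> Mor Q \<and> Src Q y = Rng Q z \<and>
        Deg Q y = m \<and> Deg Q z = n \<and> x = Comp Q y z"
        using qr xqr by (simp add: class_mem composable_iff Deg_class Comp_class)
    next
      fix t assume "case t of (y, z) \<Rightarrow> y \<in> Mor Q \<and> z \<in> Mor Q \<and> Src Q y = Rng Q z \<and>
        Deg Q y = m \<and> Deg Q z = n \<and> x = Comp Q y z"
      then obtain y z where t: "t = (y, z)" "y \<in> Mor Q" "z \<in> Mor Q" "Src Q y = Rng Q z"
        "Deg Q y = m" "Deg Q z = n" "x = Comp Q y z" by (cases t) auto
      then obtain q' r' where qr': "q' \<in> paths G" "y = R `` {q'}" "r' \<in> paths G" "z = R `` {r'}"
        by (auto simp: Mor_iff)
      have c: "path_src q' = path_rng G r'" using t qr' by (simp add: composable_iff)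
      have "(path_comp q' r', path_comp q r) \<in> R"
        using xqr t(7) qr' qr c comp_mem by (simp add: Comp_class class_eq_iff)
      then have "(q', q) \<in> R \<and> (r', r) \<in> R"
        using unique[OF qr'(1,3) c qr(1-3)] t qr' qr by (simp add: Deg_class)
      then show "t = (R `` {q}, R `` {r})"
        using t qr' qr by (simp add: class_eq_iff)
    qed
  qed
qed

lemma vertices_quotient: "vertices Q = (\<lambda>u. R `` {(u, [])}) ` verts (graph G)"
proof (intro equalityI subsetI)
  fix X assume "X \<in> vertices Q"
  then obtain p where p: "p \<in> paths G" "X = R `` {p}" "path_deg G p = 0"
    by (auto simp: vertices_def of_degree_def Mor_iff Deg_class)
  then have "snd p = []" using sum_path_deg[OF wf colors p(1)] by simp
  with p show "X \<in> (\<lambda>u. R `` {(u, [])}) ` verts (graph G)" by (cases p) auto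
qed (auto simp: vertices_def of_degree_def Deg_class class_mem)

lemma edges_quotient:
  assumes u: "u \<in> verts (graph G)"
  shows "{X \<in> of_degree Q (axis i 1). Rng Q X = R `` {(u, [])}} =
    (\<lambda>e. R `` {(tail (graph G) e, [e])}) `
      {e \<in> arcs (graph G). color G e = axis i 1 \<and> head (graph G) e = u}" (is "?A = ?B")
proof (intro equalityI subsetI)
  fix X assume "X \<in> ?A"
  then obtain p where p: "p \<in> paths G" "X = R `` {p}" "path_deg G p = axis i 1"
    "path_rng G p = u"
    using u by (auto simp: of_degree_def Mor_iff Deg_class Rng_class vertex_class_eq_iff
        path_rng_mem[OF wf])
  then have "length (snd p) = 1" using sum_path_deg[OF wf colors p(1)] by (simp add: sum_axis)
  then obtain x e where "p = (x, [e])" by (cases p) (auto simp: length_Suc_conv)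
  then show "X \<in> ?B"
    using p by (auto simp: Cons_iff )
next
  fix X assume "X \<in> ?B"
  then obtain e where e: "e \<in> arcs (graph G)" "color G e = axis i 1" "head (graph G) e = u"
    "X = R `` {(tail (graph G) e, [e])}" by blast
  then have "(tail (graph G) e, [e]) \<in> paths G" using u by (simp add: Cons_iff)
  then show "X \<in> ?A"
    using e by (simp add: of_degree_def class_mem Deg_class Rng_class
        )
qed

end


section \<open>Paths in the 1-skeleton of a k-graph\<close>

context kgraph
begin

abbreviation "S \<equiv> skeleton L"

lemma factor:
  assumes "x \<in> Mor L" "Deg L x = n + m"
  obtains y z where "y \<in> Mor L" "z \<in> Mor L" "Src L y = Rng L z"
    "Deg L y = m" "Deg L z = n" "x = Comp L y z"
  using factorization[OF assms] by auto

text \<open>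
  Only the right factors are required to have equal degrees: then so have the left factors,
  because addition of degrees is cancellative.
\<close>

lemma factor_unique:
  assumes "y \<in> Mor L" "z \<in> Mor L" "Src L y = Rng L z"
    and "y' \<in> Mor L" "z' \<in> Mor L" "Src L y' = Rng L z'"
    and eq: "Comp L y z = Comp L y' z'" and deg: "Deg L z = Deg L z'"
  shows "y = y'" "z = z'"
proof -
  have x: "Comp L y z \<in> Mor L" using assms by (simp add: Comp_mem)
  have d: "Deg L (Comp L y z) = Deg L z + Deg L y"
    unfolding Deg_Comp[OF assms(1-3)] by (rule add.commute)
  have "Deg L z + Deg L y = Deg L z + Deg L y'"
    using d unfolding eq Deg_Comp[OF assms(4-6)] deg by (simp only: add.commute)
  then have d': "Deg L y = Deg L y'" by (rule add_left_imp_eq)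
  have "(y, z) = (y', z')"
    by (rule ex1E[OF factorization[OF x d]]) (use assms d' in \<open>auto dest!: spec\<close>)
  then show "y = y'" "z = z'" by simp_all
qed

lemma Rng_vertex: "x \<in> Mor L \<Longrightarrow> Rng L x \<in> vertices L"
  by (simp add: vertices_def of_degree_def Rng_mem Rng_Rng Deg_identity)

lemma Src_vertex: "x \<in> Mor L \<Longrightarrow> Src L x \<in> vertices L"
  by (simp add: vertices_def of_degree_def Src_mem Rng_Src Deg_identity)

lemma vertex_ends:
  assumes "u \<in> vertices L"
  shows "u \<in> Mor L" "Rng L u = u" "Src L u = u"
proof -
  show u: "u \<in> Mor L" using assms by (simp add: vertices_def of_degree_def)
  have d: "Deg L u = 0" "Deg L (Src L u) = 0"
    using assms Src_vertex[OF u] by (simp_all add: vertices_def of_degree_def)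
  note unique = factor_unique[of "Rng L u" u u "Src L u"]
  show "Rng L u = u"
    by (rule unique(1)) (simp_all add: u d Rng_mem Src_mem Src_Rng Rng_Src Comp_Rng Comp_Src)
  show "Src L u = u"
    by (rule unique(2)[symmetric])
      (simp_all add: u d Rng_mem Src_mem Src_Rng Rng_Src Comp_Rng Comp_Src)
qed

lemma edges_mem: "e \<in> edges L \<Longrightarrow> e \<in> Mor L"
  by (simp add: edges_def)

lemma edge_axis: "e \<in> edges L \<Longrightarrow> \<exists>i. Deg L e = axis i 1"
proof -
  assume "e \<in> edges L"
  then have "(\<Sum>i\<in>UNIV. Deg L e $ i) = 1" by (simp add: edges_def)
  then obtain i where "Deg L e $ i = 1" "\<forall>j. i \<noteq> j \<longrightarrow> Deg L e $ j = 0"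
    by (subst (asm) sum_eq_1_iff) auto
  then have "Deg L e = axis i 1" by (auto simp: vec_eq_iff axis_def)
  then show ?thesis ..
qed

lemma edgeI: "e \<in> Mor L \<Longrightarrow> Deg L e = axis i 1 \<Longrightarrow> e \<in> edges L"
  by (simp add: edges_def sum_axis)

lemma skeleton_simps [simp]:
  "verts (graph S) = vertices L" "arcs (graph S) = edges L"
  "tail (graph S) = Src L" "head (graph S) = Rng L" "color S = Deg L"
  by (simp_all add: skeleton_def)

lemma wf_skeleton: "wf_digraph (graph S)"
  by unfold_locales (simp_all add: edges_mem Src_vertex Rng_vertex)

lemmas skeleton_Cons = paths_Cons[OF wf_skeleton, simplified]

lemma fold_Comp:
  assumes "x \<in> Mor L" "(Rng L x, es) \<in> paths S"
  shows "fold (Comp L) es x \<in> Mor L" "Src L (fold (Comp L) es x) = Src L x"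
    "Rng L (fold (Comp L) es x) = path_rng S (Rng L x, es)"
    "Deg L (fold (Comp L) es x) = Deg L x + path_deg S (Rng L x, es)"
proof -
  have "fold (Comp L) es x \<in> Mor L \<and> Src L (fold (Comp L) es x) = Src L x \<and>
    Rng L (fold (Comp L) es x) = path_rng S (Rng L x, es) \<and>
    Deg L (fold (Comp L) es x) = Deg L x + path_deg S (Rng L x, es)"
    using assms
  proof (induction es arbitrary: x)
    case (Cons e es)
    then have e: "e \<in> Mor L" "Src L e = Rng L x" "(Rng L e, es) \<in> paths S"
      by (auto simp: skeleton_Cons edges_mem)
    with Cons.prems Cons.IH[of "Comp L e x"] show ?case
      by (simp add: Comp_mem Rng_Comp Src_Comp Deg_Comp ac_simps)
  qed simp
  then show "fold (Comp L) es x \<in> Mor L" "Src L (fold (Comp L) es x) = Src L x"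
    "Rng L (fold (Comp L) es x) = path_rng S (Rng L x, es)"
    "Deg L (fold (Comp L) es x) = Deg L x + path_deg S (Rng L x, es)" by simp_all
qed

lemma path_eval_props:
  assumes "p \<in> paths S"
  shows "path_eval L p \<in> Mor L" "Src L (path_eval L p) = path_src p"
    "Rng L (path_eval L p) = path_rng S p" "Deg L (path_eval L p) = path_deg S p"
proof -
  obtain u es where p: "p = (u, es)" by (cases p)
  have "u \<in> vertices L" using path_src_mem[OF assms] p by simp
  then have u: "u \<in> Mor L" "Rng L u = u" "Src L u = u" "Deg L u = 0"
    using vertex_ends[of u] by (simp_all add: vertices_def of_degree_def)
  show "path_eval L p \<in> Mor L" "Src L (path_eval L p) = path_src p"
    "Rng L (path_eval L p) = path_rng S p" "Deg L (path_eval L p) = path_deg S p"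
    using fold_Comp[of u es] u assms p by (simp_all add: path_eval_def)
qed

lemma path_eval_Nil [simp]: "path_eval L (u, []) = u"
  by (simp add: path_eval_def)

lemma fold_Comp_eq:
  assumes "x \<in> Mor L" "(Rng L x, es) \<in> paths S"
  shows "fold (Comp L) es x = Comp L (path_eval L (Rng L x, es)) x"
  using assms
proof (induction es arbitrary: x)
  case Nil
  then show ?case by (simp add: Comp_Rng)
next
  case (Cons e es)
  then have e: "e \<in> Mor L" "Src L e = Rng L x" "(Rng L e, es) \<in> paths S"
    by (auto simp: skeleton_Cons edges_mem)
  note t = path_eval_props[OF e(3)]
  have 1: "fold (Comp L) (e # es) x = Comp L (path_eval L (Rng L e, es)) (Comp L e x)"
    using Cons.IH[of "Comp L e x"] Cons.prems e by (simp add: Comp_mem Rng_Comp)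
  have "path_eval L (Rng L x, e # es) = fold (Comp L) es e"
    using Comp_Src[OF e(1)] e(2) by (simp add: path_eval_def)
  also have "\<dots> = Comp L (path_eval L (Rng L e, es)) e"
    using Cons.IH[of e] e by simp
  finally show ?case using 1 t e Cons.prems by (simp add: Comp_assoc)
qed

lemma path_eval_Cons:
  assumes "(u, e # es) \<in> paths S"
  shows "path_eval L (u, e # es) = Comp L (path_eval L (Rng L e, es)) e"
proof -
  have e: "e \<in> Mor L" "Src L e = u" "(Rng L e, es) \<in> paths S"
    using assms by (auto simp: skeleton_Cons edges_mem)
  then show ?thesis
    using fold_Comp_eq[OF e(1,3)] Comp_Src[OF e(1)] by (simp add: path_eval_def)
qed

lemma path_eval_comp:
  assumes "p \<in> paths S" "q \<in> paths S" "path_src p = path_rng S q"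
  shows "path_eval L (path_comp p q) = Comp L (path_eval L p) (path_eval L q)"
proof -
  obtain x fs u es where p: "p = (x, fs)" and q: "q = (u, es)" by (cases p; cases q)
  note q' = path_eval_props[OF assms(2)]
  have "path_eval L (path_comp p q) = fold (Comp L) fs (path_eval L q)"
    by (simp add: p q path_comp_def path_eval_def)
  also have "\<dots> = Comp L (path_eval L (Rng L (path_eval L q), fs)) (path_eval L q)"
    using assms p q'(1,3) by (intro fold_Comp_eq) simp_all
  finally show ?thesis using assms p q' by simp
qed

lemma path_eval_pair:
  assumes "a \<in> edges L" "b \<in> edges L" "Src L b = Rng L a"
  shows "edge_pair L b a \<in> paths S" "path_eval L (edge_pair L b a) = Comp L b a"
proof -
  show "edge_pair L b a \<in> paths S"
    using assms by (simp add: edge_pair_def skeleton_Cons Rng_vertex edges_mem)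
  show "path_eval L (edge_pair L b a) = Comp L b a"
    using assms Comp_Src[of a] by (simp add: edge_pair_def path_eval_def edges_mem)
qed

lemma path_exists:
  assumes "x \<in> Mor L"
  shows "\<exists>es. (Src L x, es) \<in> paths S \<and> path_eval L (Src L x, es) = x"
  using assms
proof (induction "\<Sum>i\<in>UNIV. Deg L x $ i" arbitrary: x)
  case 0
  then have "Deg L x = 0" using vec_nat_sum_eq_0[of "Deg L x"] by simp
  then have "x \<in> vertices L" using 0 by (simp add: vertices_def of_degree_def)
  then show ?case
    using vertex_ends(3)[of x] by (intro exI[of _ "[]"]) simp
next
  case (Suc s)
  obtain i where i: "Deg L x $ i > 0"
    using Suc(2) by (metis nat.distinct(1) neq0_conv sum.neutral)
  obtain n where n: "Deg L x = axis i 1 + n"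
    using vec_nat_split[OF i] by (metis add.commute)
  obtain y z where yz: "y \<in> Mor L" "z \<in> Mor L" "Src L y = Rng L z"
    "Deg L y = n" "Deg L z = axis i 1" "x = Comp L y z"
    using factor[OF Suc.prems n] .
  have "s = (\<Sum>i\<in>UNIV. Deg L y $ i)"
    using Suc(2) n yz(4) by (simp add: sum.distrib sum_axis)
  from Suc.hyps(1)[OF this yz(1)] obtain es
    where es: "(Src L y, es) \<in> paths S" "path_eval L (Src L y, es) = y" by blast
  have "(Src L x, z # es) \<in> paths S"
    using es yz by (simp add: skeleton_Cons edgeI Src_Comp)
  with es yz show ?case
    by (intro exI[of _ "z # es"]) (simp add: path_eval_Cons)
qed

lemma swap_edges:
  assumes "a \<in> edges L" "b \<in> edges L" "Src L b = Rng L a"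
  obtains a' b' where "a' \<in> edges L" "b' \<in> edges L" "Src L b' = Rng L a'"
    "Deg L a' = Deg L b" "Deg L b' = Deg L a" "Comp L b a = Comp L b' a'"
    "Src L a' = Src L a" "Rng L b' = Rng L b"
proof -
  have ab: "a \<in> Mor L" "b \<in> Mor L" using assms by (simp_all add: edges_mem)
  have "Comp L b a \<in> Mor L" "Deg L (Comp L b a) = Deg L b + Deg L a"
    using ab assms by (simp_all add: Comp_mem Deg_Comp)
  then obtain b' a' where *: "b' \<in> Mor L" "a' \<in> Mor L" "Src L b' = Rng L a'"
    "Deg L b' = Deg L a" "Deg L a' = Deg L b" "Comp L b a = Comp L b' a'"
    by (rule factor)
  have "a' \<in> edges L" "b' \<in> edges L" using * assms by (simp_all add: edges_def)
  moreover have "Src L a' = Src L a" "Rng L b' = Rng L b"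
    using * ab assms Src_Comp Rng_Comp by metis+
  ultimately show ?thesis using that * by blast
qed

end


section \<open>Reduction of a k-graph at a vertex\<close>

text \<open>
  The code \<open>True \<mapsto> True False\<close>, \<open>False \<mapsto> False\<close> is a prefix code. It describes the effect of \<open>par\<close>
  on the word that records which edges of a path enter \<open>v\<close>.
\<close>

lemma mark_code_inj:
  "concat (map (\<lambda>b. if b then [True, False] else [False]) xs) =
    concat (map (\<lambda>b. if b then [True, False] else [False]) ys) \<Longrightarrow> xs = ys"
proof (induction xs arbitrary: ys)
  case Nil
  then show ?case by (cases ys) (auto split: if_splits)
next
  case (Cons x xs)
  then show ?case by (cases ys) (auto split: if_splits)
qed

text \<open>
  A vertex \<open>v\<close> at which a k-graph can be reduced, with the edge \<open>f\<close> chosen to leave \<open>v\<close>. The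
  common range of the edges with source \<open>v\<close> is \<open>Rng L f\<close>.
\<close>

locale vertex_reduction = kgraph L
  for L :: "('m, 'k::finite) kgraph_data" +
  fixes v f :: 'm
  assumes v_vertex: "v \<in> vertices L"
    and complete: "complete_edge L (edges_from L v)"
    and v_ne: "v \<noteq> common_rng L (edges_from L v)"
    and f_from: "f \<in> edges_from L v"
begin

abbreviation "D \<equiv> reduced_digraph L v"
abbreviation "T \<equiv> reduced_sim L v f"

abbreviation enters :: "'m \<Rightarrow> bool" where
  "enters e \<equiv> Rng L e = v"

lemma f_edge: "f \<in> edges L" "Src L f = v"
  using f_from by (simp_all add: edges_from_def)

lemma edge_from_v:
  assumes "e \<in> edges L" "Src L e = v"
  shows "Rng L e = Rng L f" "Deg L e = Deg L f \<Longrightarrow> e = f"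
proof -
  have e: "e \<in> edges_from L v" using assms by (simp add: edges_from_def)
  then show "Rng L e = Rng L f" using complete f_from unfolding complete_edge_def by blast
  obtain i where i: "Deg L f = axis i 1" using edge_axis f_edge(1) by blast
  have "\<exists>!e. e \<in> edges_from L v \<and> Deg L e = axis i 1"
    using complete unfolding complete_edge_def by blast
  then show "Deg L e = Deg L f \<Longrightarrow> e = f" using e f_from i by metis
qed

lemma common_rng_from: "common_rng L (edges_from L v) = Rng L f"
proof -
  have "Rng L ` edges_from L v = (\<lambda>_. Rng L f) ` edges_from L v"
    by (rule image_cong[OF refl], rule edge_from_v(1)) (simp_all add: edges_from_def)
  also have "\<dots> = {Rng L f}" using f_from by (rule image_constant)
  finally show ?thesis by (simp add: common_rng_def)
qed

lemma Rng_f: "Rng L f \<noteq> v"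
  using v_ne by (simp add: common_rng_from)

text \<open>The closure condition in the definition of a complete edge, applied in both directions.\<close>

lemma square_through_v:
  assumes "a \<in> edges L" "b \<in> edges L" "Src L b = Rng L a"
    and "a' \<in> edges L" "b' \<in> edges L" "Src L b' = Rng L a'"
    and "Comp L b a = Comp L b' a'"
  shows "Src L b = v \<longleftrightarrow> Src L b' = v"
proof -
  have closed: "\<And>e a b f. \<lbrakk>e \<in> edges_from L v; a \<in> edges L; b \<in> edges L; f \<in> edges L;
      (edge_pair L e a, edge_pair L f b) \<in> path_sim L\<rbrakk> \<Longrightarrow> f \<in> edges_from L v"
    using complete unfolding complete_edge_def by blast
  have "(edge_pair L b a, edge_pair L b' a') \<in> path_sim L"
    "(edge_pair L b' a', edge_pair L b a) \<in> path_sim L"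
    using assms by (simp_all add: path_sim_def path_eval_pair)
  with closed[of b a a' b'] closed[of b' a' a b] assms show ?thesis
    by (auto simp: edges_from_def)
qed

text \<open>
  Two paths for the same morphism enter \<open>v\<close> at the same steps. If their first edges \<open>a\<close> and \<open>b\<close>
  have the same colour, then \<open>a = b\<close> and these edges can be removed. Otherwise the morphism is
  \<open>t b' a = t b2 b\<close> for some \<open>t\<close> and some edges with \<open>b' a = b2 b\<close>, and the two given paths are
  compared with the paths that start with \<open>a, b'\<close> and \<open>b, b2\<close> and continue along a common path
  for \<open>t\<close>.
\<close>

lemma entries_invariant:
  assumes "(u, es) \<in> paths S" "(u', fs) \<in> paths S"
    and "path_eval L (u, es) = path_eval L (u', fs)"
  shows "map enters es = map enters fs"
  using assms
proof (induction "length es" arbitrary: u es u' fs rule: less_induct)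
  case less
  have "length es = length fs"
    using sum_path_deg[OF wf_skeleton _ less.prems(1)] sum_path_deg[OF wf_skeleton _ less.prems(2)]
      path_eval_props(4)[OF less.prems(1)] path_eval_props(4)[OF less.prems(2)]
      less.prems(3) edge_axis by simp
  show ?case
  proof (cases es)
    case Nil
    then show ?thesis using \<open>length es = length fs\<close> by simp
  next
    case (Cons a es')
    then obtain b fs' where fs: "fs = b # fs'"
      using \<open>length es = length fs\<close> by (cases fs) auto
    have a: "a \<in> edges L" "a \<in> Mor L" "(Rng L a, es') \<in> paths S"
      and b: "b \<in> edges L" "b \<in> Mor L" "(Rng L b, fs') \<in> paths S"
      using less.prems(1,2) by (simp_all add: Cons fs skeleton_Cons edges_mem)
    define y where "y = path_eval L (Rng L a, es')"
    define z where "z = path_eval L (Rng L b, fs')"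
    have y: "y \<in> Mor L" "Src L y = Rng L a" and z: "z \<in> Mor L" "Src L z = Rng L b"
      using path_eval_props[OF a(3)] path_eval_props[OF b(3)] by (simp_all add: y_def z_def)
    have ya_zb: "Comp L y a = Comp L z b"
      using less.prems by (simp add: Cons fs path_eval_Cons y_def z_def)
    show ?thesis
    proof (cases "Deg L a = Deg L b")
      case True
      from factor_unique[OF y(1) a(2) y(2) z(1) b(2) z(2) ya_zb True]
      have "y = z" "a = b" .
      then have "map enters es' = map enters fs'"
        using less.hyps[OF _ a(3) b(3)] by (simp add: Cons y_def z_def)
      then show ?thesis using \<open>a = b\<close> by (simp add: Cons fs)
    next
      case False
      obtain i j where ij: "Deg L a = axis i 1" "Deg L b = axis j 1"
        using edge_axis a(1) b(1) by blast
      have "Deg L y + Deg L a = Deg L z + Deg L b"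
        using Deg_Comp[OF y(1) a(2) y(2)] Deg_Comp[OF z(1) b(2) z(2)] ya_zb by simp
      then have "Deg L y $ j + Deg L a $ j = Deg L z $ j + Deg L b $ j"
        by (metis vector_add_component)
      moreover have "i \<noteq> j" using ij False by metis
      ultimately have "Deg L y $ j > 0" using ij by (simp add: axis_def)
      then obtain n where "Deg L y = axis j 1 + n"
        by (metis vec_nat_split add.commute)
      with y(1) obtain t b' where t: "t \<in> Mor L" "b' \<in> Mor L" "Src L t = Rng L b'"
        "Deg L t = n" "Deg L b' = axis j 1" "y = Comp L t b'"
        by (rule factor)
      have b': "b' \<in> edges L" "Src L b' = Rng L a"
        using t y(2) edgeI by (simp_all add: Src_Comp)
      obtain a2 b2 where s: "a2 \<in> edges L" "b2 \<in> edges L" "Src L b2 = Rng L a2"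
        "Deg L a2 = Deg L b'" "Deg L b2 = Deg L a" "Comp L b' a = Comp L b2 a2"
        "Src L a2 = Src L a" "Rng L b2 = Rng L b'"
        using swap_edges[OF a(1) b'] .
      note s' = edges_mem[OF s(1)] edges_mem[OF s(2)]
      have eq: "Comp L (Comp L t b2) a2 = Comp L z b"
        using ya_zb t s s' b' a(2) by (simp add: Comp_assoc)
      have tb: "Comp L t b2 \<in> Mor L" "Src L (Comp L t b2) = Rng L a2"
        using t s s' by (simp_all add: Comp_mem Src_Comp)
      have "Deg L a2 = Deg L b" using s(4) t(5) ij(2) by simp
      from factor_unique[OF tb(1) s'(1) tb(2) z(1) b(2) z(2) eq this]
      have zb: "Comp L t b2 = z" "a2 = b" .
      obtain ts where ts: "(Src L t, ts) \<in> paths S" "path_eval L (Src L t, ts) = t"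
        using path_exists[OF t(1)] by blast
      have p1: "(Rng L a, b' # ts) \<in> paths S"
        using ts(1) t(3) b' by (simp add: skeleton_Cons)
      have e1: "path_eval L (Rng L a, b' # ts) = y"
        using path_eval_Cons[OF p1] ts(2) t(3,6) by simp
      have tb2: "Src L t = Rng L b2" using t(3) s(8) by simp
      have p2: "(Rng L b, b2 # ts) \<in> paths S"
        using ts(1) tb2 s(2,3) zb(2) by (simp add: skeleton_Cons)
      have e2: "path_eval L (Rng L b, b2 # ts) = z"
        using path_eval_Cons[OF p2] ts(2) tb2 zb(1) by simp
      have m1: "map enters es' = map enters (b' # ts)"
        by (rule less.hyps[OF _ a(3) p1]) (simp_all add: Cons e1 y_def)
      have "length (b2 # ts) < length es"
        using map_eq_imp_length_eq[OF m1] by (simp add: Cons)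
      from less.hyps[OF this p2 b(3)] have m2: "map enters (b2 # ts) = map enters fs'"
        by (simp only: e2 z_def)
      have "enters a = enters b"
        using square_through_v[OF a(1) b' s(1-3,6)] b' s(3) zb(2) by simp
      then show ?thesis using m1 m2 s(8) by (simp add: Cons fs)
    qed
  qed
qed

lemma reduced_simps [simp]:
  "verts (graph D) = vertices L - {v}"
  "arcs (graph D) = edges L - edges_from L v"
  "tail (graph D) = Src L"
  "head (graph D) = (\<lambda>e. if enters e then Rng L f else Rng L e)"
  "color D = Deg L"
  by (simp_all add: reduced_digraph_def common_rng_from cong: if_cong)

lemma wf_reduced: "wf_digraph (graph D)"
  by unfold_locales
    (auto simp: edges_mem Src_vertex Rng_vertex edges_from_def f_edge(1) Rng_f)

lemmas reduced_Cons = paths_Cons[OF wf_reduced, simplified]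

lemma colors_reduced: "e \<in> arcs (graph D) \<Longrightarrow> \<exists>i. color D e = axis i 1"
  using edge_axis by simp

lemma par_Nil [simp]: "par L v f (u, []) = (u, [])"
  by (simp add: par_def)

lemma par_src [simp]: "path_src (par L v f p) = path_src p"
  by (simp add: par_def path_src_def)

lemma par_comp: "par L v f (path_comp p q) = path_comp (par L v f p) (par L v f q)"
  by (simp add: par_def path_comp_def)

lemma par_entries:
  "map enters (snd (par L v f p)) =
    concat (map (\<lambda>b. if b then [True, False] else [False]) (map enters (snd p)))"
proof -
  have "map enters (concat (map (\<lambda>e. if enters e then [e, f] else [e]) es)) =
    concat (map (\<lambda>b. if b then [True, False] else [False]) (map enters es))" for es
    using Rng_f by (induction es) auto
  then show ?thesis by (simp add: par_def)
qed

lemma par_props: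
  assumes "p \<in> paths D"
  shows "par L v f p \<in> paths S" "path_rng S (par L v f p) = path_rng D p"
    "path_deg S (par L v f p) =
      path_deg D p + sum_list (map (\<lambda>b. if b then Deg L f else 0) (map enters (snd p)))"
proof -
  have "(u, es) \<in> paths D \<Longrightarrow> par L v f (u, es) \<in> paths S \<and>
    path_rng S (par L v f (u, es)) = path_rng D (u, es) \<and>
    path_deg S (par L v f (u, es)) =
      path_deg D (u, es) + sum_list (map (\<lambda>b. if b then Deg L f else 0) (map enters es))"
    for u es
  proof (induction es arbitrary: u)
    case (Cons e es)
    then show ?case
      using f_edge by (cases "enters e")
        (auto simp: reduced_Cons skeleton_Cons par_def ac_simps)
  qed simp
  then show "par L v f p \<in> paths S" "path_rng S (par L v f p) = path_rng D p"
    "path_deg S (par L v f p) =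
      path_deg D p + sum_list (map (\<lambda>b. if b then Deg L f else 0) (map enters (snd p)))"
    using assms by (cases p; simp)+
qed

lemma sim_iff: "(p, q) \<in> T \<longleftrightarrow>
    p \<in> paths D \<and> q \<in> paths D \<and> path_eval L (par L v f p) = path_eval L (par L v f q)"
  by (auto simp: reduced_sim_def path_sim_def par_props)

lemma sim_entries:
  assumes "(p, q) \<in> T"
  shows "map enters (snd p) = map enters (snd q)"
proof (rule mark_code_inj)
  have "map enters (snd (par L v f p)) = map enters (snd (par L v f q))"
    using assms par_props(1)[of p] par_props(1)[of q]
    by (intro entries_invariant[of "fst (par L v f p)" _ "fst (par L v f q)"])
      (simp_all add: sim_iff)
  then show "concat (map (\<lambda>b. if b then [True, False] else [False]) (map enters (snd p))) =
    concat (map (\<lambda>b. if b then [True, False] else [False]) (map enters (snd q)))"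
    by (simp only: par_entries)
qed

lemma sim_path_deg:
  assumes "(p, q) \<in> T"
  shows "path_deg D p = path_deg D q"
proof -
  have pq: "p \<in> paths D" "q \<in> paths D"
    and eq: "path_eval L (par L v f p) = path_eval L (par L v f q)"
    using assms by (auto simp: sim_iff)
  have "path_deg S (par L v f p) = path_deg S (par L v f q)"
    using path_eval_props(4)[OF par_props(1)[OF pq(1)]]
      path_eval_props(4)[OF par_props(1)[OF pq(2)]] eq by simp
  then show ?thesis
    unfolding par_props(3)[OF pq(1)] par_props(3)[OF pq(2)] sim_entries[OF assms]
    by (rule add_right_imp_eq)
qed

text \<open>
  The morphism of \<open>L\<close> that an edge of the reduced graph stands for: the value of \<open>par\<close> on that
  edge. It has degree \<open>d(f) + d(e)\<close> in \<open>L\<close> if \<open>e\<close> enters \<open>v\<close>.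
\<close>

definition edge_eval :: "'m \<Rightarrow> 'm" where
  "edge_eval e = (if enters e then Comp L f e else e)"

lemma path_eval_par_pair:
  assumes "(u, [a, b]) \<in> paths D"
  shows "path_eval L (par L v f (u, [a, b])) = Comp L (edge_eval b) (edge_eval a)"
proof -
  have 1: "path_eval L (par L v f (x, [e])) = edge_eval e" if "(x, [e]) \<in> paths D" for x e
    using that Comp_Src[of e]
    by (auto simp: reduced_Cons par_def path_eval_def edge_eval_def edges_mem)
  let ?h = "head (graph D) a"
  have ab: "(?h, [b]) \<in> paths D" "(u, [a]) \<in> paths D"
    using assms path_src_mem[of "(?h, [b])" D] by (simp_all add: reduced_Cons)
  have "par L v f (u, [a, b]) = path_comp (par L v f (?h, [b])) (par L v f (u, [a]))"
    by (simp add: par_def path_comp_def)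
  then have "path_eval L (par L v f (u, [a, b])) =
    Comp L (path_eval L (par L v f (?h, [b]))) (path_eval L (par L v f (u, [a])))"
    using par_props[OF ab(1)] par_props[OF ab(2)] by (simp add: path_eval_comp)
  then show ?thesis using 1[OF ab(1)] 1[OF ab(2)] by simp
qed

text \<open>
  Two edges with the same range either both enter \<open>v\<close> or both do not, so an equation between
  composites survives the passage from \<open>b\<close>, \<open>b'\<close> to their values in the reduced graph.
\<close>

lemma Comp_edge_eval:
  assumes "b \<in> Mor L" "x \<in> Mor L" "Src L b = Rng L x"
    and "b' \<in> Mor L" "x' \<in> Mor L" "Src L b' = Rng L x'"
    and "Comp L b x = Comp L b' x'" "Rng L b = Rng L b'"
  shows "Comp L (edge_eval b) x = Comp L (edge_eval b') x'"
  using assms f_edge edges_mem[OF f_edge(1)] by (simp add: edge_eval_def Comp_assoc)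

lemma swap_reduced:
  assumes a: "a \<in> arcs (graph D)" and b: "b \<in> arcs (graph D)"
    and ab: "head (graph D) a = tail (graph D) b"
  shows "\<exists>a' b'. color D a' = color D b \<and> color D b' = color D a \<and>
    ((tail (graph D) a, [a, b]), (tail (graph D) a, [a', b'])) \<in> T"
proof -
  have a': "a \<in> edges L" "Src L a \<noteq> v" and b': "b \<in> edges L" "Src L b \<noteq> v"
    using a b by (auto simp: edges_from_def)
  note M = edges_mem[OF a'(1)] edges_mem[OF b'(1)] edges_mem[OF f_edge(1)]
  have path: "(Src L x, [x, y]) \<in> paths D"
    if "x \<in> edges L" "y \<in> edges L" "Src L x \<noteq> v" "Src L y \<noteq> v"
      "(if enters x then Rng L f else Rng L x) = Src L y" for x y
    using that Rng_f
    by (auto simp: reduced_Cons edges_from_def edges_mem Rng_vertex f_edge(1))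
  have sim: "((Src L a, [a, b]), (Src L a, [x, y])) \<in> T"
    if "x \<in> edges L" "y \<in> edges L" "Src L x = Src L a" "Src L y \<noteq> v"
      "(if enters x then Rng L f else Rng L x) = Src L y"
      "Comp L (edge_eval b) (edge_eval a) = Comp L (edge_eval y) (edge_eval x)" for x y
    using path[of x y] path[of a b] that a' b' ab
    by (simp add: sim_iff path_eval_par_pair)
  show ?thesis
  proof (cases "enters a")
    case False
    then have s: "Src L b = Rng L a" using ab by simp
    obtain x y where xy: "x \<in> edges L" "y \<in> edges L" "Src L y = Rng L x"
      "Deg L x = Deg L b" "Deg L y = Deg L a" "Comp L b a = Comp L y x"
      "Src L x = Src L a" "Rng L y = Rng L b"
      using swap_edges[OF a'(1) b'(1) s] .
    have y: "Src L y \<noteq> v" using square_through_v[OF a'(1) b'(1) s xy(1-3,6)] b'(2) by simp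
    then have x: "\<not> enters x" using xy(3) by simp
    have "Comp L (edge_eval b) a = Comp L (edge_eval y) x"
      using xy M s by (intro Comp_edge_eval) (simp_all add: edges_mem)
    then have "((Src L a, [a, b]), (Src L a, [x, y])) \<in> T"
      using x y xy False by (intro sim) (simp_all add: edge_eval_def)
    then show ?thesis using xy(4,5) by auto
  next
    case True
    then have s: "Src L b = Rng L f" "Src L f = Rng L a" using ab f_edge by simp_all
    obtain g h where gh: "h \<in> edges L" "g \<in> edges L" "Src L g = Rng L h"
      "Deg L h = Deg L f" "Deg L g = Deg L a" "Comp L f a = Comp L g h"
      "Src L h = Src L a" "Rng L g = Rng L f"
      using swap_edges[OF a'(1) f_edge(1) s(2)] .
    \<comment> \<open>In each exchange below the vertex reached by the first edge remains \<open>v\<close>.\<close>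
    have g: "Src L g = v"
      using square_through_v[OF a'(1) f_edge(1) s(2) gh(1-3,6)] f_edge by simp
    have bg: "Src L b = Rng L g" using s gh by simp
    obtain g' y where y: "g' \<in> edges L" "y \<in> edges L" "Src L y = Rng L g'"
      "Deg L g' = Deg L b" "Deg L y = Deg L g" "Comp L b g = Comp L y g'"
      "Src L g' = Src L g" "Rng L y = Rng L b"
      using swap_edges[OF gh(2) b'(1) bg] .
    have gh': "Src L g' = Rng L h" using y(7) gh(3) by simp
    obtain x f' where x: "x \<in> edges L" "f' \<in> edges L" "Src L f' = Rng L x"
      "Deg L x = Deg L g'" "Deg L f' = Deg L h" "Comp L g' h = Comp L f' x"
      "Src L x = Src L h" "Rng L f' = Rng L g'"
      using swap_edges[OF gh(1) y(1) gh'] .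
    have "Src L f' = v"
      using square_through_v[OF gh(1) y(1) gh' x(1-3,6)] y(7) g by simp
    then have f': "f' = f" using edge_from_v(2)[OF x(2)] x(5) gh(4) by simp
    note N = edges_mem[OF gh(1)] edges_mem[OF gh(2)] edges_mem[OF y(1)] edges_mem[OF y(2)]
      edges_mem[OF x(1)]
    have yf: "Src L y = Rng L f" using y(3) x(8) f' by simp
    have fx: "Src L f = Rng L x" using x(3) f' by simp
    have "Comp L b (Comp L f a) = Comp L (Comp L b g) h"
      using M N bg gh by (simp add: Comp_assoc)
    also have "\<dots> = Comp L y (Comp L g' h)"
      using M N y gh' by (simp add: Comp_assoc)
    also have "\<dots> = Comp L y (Comp L f x)" using x(6) f' by simp
    finally have "Comp L (edge_eval b) (Comp L f a) = Comp L (edge_eval y) (Comp L f x)"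
      using M N s yf fx y(8)
      by (intro Comp_edge_eval) (simp_all add: Comp_mem Rng_Comp)
    moreover have ex: "enters x" using fx f_edge by simp
    ultimately have "((Src L a, [a, b]), (Src L a, [x, y])) \<in> T"
      using x(1,7) y(2) gh(7) yf Rng_f True
      by (intro sim) (simp_all add: edge_eval_def)
    then show ?thesis using x(4) y(4,5) gh(5) by auto
  qed
qed

lemma path_congruence_reduced: "path_congruence D T"
proof (rule path_congruence.intro)
  show "equiv (paths D) T"
    by (rule equivI) (auto simp: refl_on_def sym_def trans_def sim_iff)
next
  fix p q assume "(p, q) \<in> T"
  then have pq: "p \<in> paths D" "q \<in> paths D"
    and eq: "path_eval L (par L v f p) = path_eval L (par L v f q)" by (auto simp: sim_iff)
  note P = par_props[OF pq(1)] par_props[OF pq(2)]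
  show "path_src p = path_src q" "path_rng D p = path_rng D q"
    using path_eval_props[OF P(1)] path_eval_props[OF P(4)] eq P by simp_all
next
  fix p p' q q' assume *: "(p, p') \<in> T" "(q, q') \<in> T" "path_src p = path_rng D q"
  then have m: "p \<in> paths D" "p' \<in> paths D" "q \<in> paths D" "q' \<in> paths D"
    and eq: "path_eval L (par L v f p) = path_eval L (par L v f p')"
      "path_eval L (par L v f q) = path_eval L (par L v f q')" by (auto simp: sim_iff)
  have c: "path_src p' = path_rng D q'"
    using path_eval_props[OF par_props(1)[OF m(1)]] path_eval_props[OF par_props(1)[OF m(2)]]
      path_eval_props[OF par_props(1)[OF m(3)]] path_eval_props[OF par_props(1)[OF m(4)]]
      eq *(3) by (simp add: par_props m)
  show "(path_comp p q, path_comp p' q') \<in> T"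
    using m eq c *(3)
    by (simp add: sim_iff path_comp_mem[OF wf_reduced] par_comp path_eval_comp par_props)
qed (fact wf_reduced colors_reduced sim_path_deg swap_reduced)+

text \<open>
  The words of \<open>q r\<close> and \<open>q' r'\<close> agree, and the words of \<open>r\<close> and \<open>r'\<close> are initial segments of them
  of the same length \<open>\<bar>d(r)\<bar> = \<bar>d(r')\<bar>\<close>. Hence \<open>f\<close> is inserted equally often into \<open>r\<close> and \<open>r'\<close>.
\<close>

lemma reduced_unique_factorization:
  assumes q: "q \<in> paths D" and r: "r \<in> paths D" and qr: "path_src q = path_rng D r"
    and q': "q' \<in> paths D" and r': "r' \<in> paths D" and qr': "path_src q' = path_rng D r'"
    and deg: "path_deg D r = path_deg D r'"
    and sim: "(path_comp q r, path_comp q' r') \<in> T"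
  shows "(q, q') \<in> T \<and> (r, r') \<in> T"
proof -
  have "map enters (snd r) @ map enters (snd q) = map enters (snd r') @ map enters (snd q')"
    using sim_entries[OF sim] by (simp add: path_comp_def)
  moreover have "length (snd r) = length (snd r')"
    using sum_path_deg[OF wf_reduced colors_reduced r]
      sum_path_deg[OF wf_reduced colors_reduced r'] deg by simp
  ultimately have "map enters (snd r) = map enters (snd r')" by simp
  then have deg': "path_deg S (par L v f r) = path_deg S (par L v f r')"
    using deg by (simp only: par_props(3)[OF r] par_props(3)[OF r'])
  note P = par_props[OF q] par_props[OF r] par_props[OF q'] par_props[OF r']
  note E = path_eval_props[OF P(1)] path_eval_props[OF P(4)]
    path_eval_props[OF P(7)] path_eval_props[OF P(10)]
  have "path_eval L (path_comp (par L v f q) (par L v f r)) =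
      path_eval L (path_comp (par L v f q') (par L v f r'))"
    using sim by (simp add: sim_iff par_comp)
  then have "Comp L (path_eval L (par L v f q)) (path_eval L (par L v f r)) =
      Comp L (path_eval L (par L v f q')) (path_eval L (par L v f r'))"
    using P qr qr' by (simp add: path_eval_comp)
  moreover have "Deg L (path_eval L (par L v f r)) = Deg L (path_eval L (par L v f r'))"
    using E(8,16) deg' by simp
  ultimately have "path_eval L (par L v f q) = path_eval L (par L v f q')"
    "path_eval L (par L v f r) = path_eval L (par L v f r')"
    using factor_unique[OF E(1,5) _ E(9,13)] E P qr qr' by simp_all
  then show ?thesis using q r q' r' by (simp add: sim_iff)
qed

lemma kgraph_reduced: "kgraph (reduced_kgraph L v f)"
  unfolding reduced_kgraph_def
proof (rule path_congruence.kgraph_quotient[OF path_congruence_reduced])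
  have "vertices L \<subseteq> Mor L" "edges L \<subseteq> Mor L"
    by (auto simp: vertices_def of_degree_def edges_def)
  then show "countable (verts (graph D))" "countable (arcs (graph D))"
    using countable_Mor by (auto intro: countable_subset)
qed (use reduced_unique_factorization in blast)

lemma row_finite_reduced:
  assumes "row_finite L"
  shows "row_finite (reduced_kgraph L v f)"
  unfolding row_finite_def reduced_kgraph_def
    path_congruence.vertices_quotient[OF path_congruence_reduced]
proof (intro ballI allI)
  fix X i assume "X \<in> (\<lambda>u. T `` {(u, [])}) ` verts (graph D)"
  then obtain u where u: "u \<in> verts (graph D)" "X = T `` {(u, [])}" by blast
  have fin: "finite {x \<in> of_degree L (axis i 1). Rng L x = u}" if "u \<in> vertices L" for u
    using assms that by (simp add: row_finite_def)
  have "{e \<in> arcs (graph D). color D e = axis i 1 \<and> head (graph D) e = u} \<subseteq>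
      {x \<in> of_degree L (axis i 1). Rng L x = u} \<union> {x \<in> of_degree L (axis i 1). Rng L x = v}"
    by (auto simp: of_degree_def edges_mem)
  then have "finite {e \<in> arcs (graph D). color D e = axis i 1 \<and> head (graph D) e = u}"
    by (rule finite_subset) (use fin u v_vertex in simp)
  then show "finite {x \<in> of_degree (path_quotient D T) (axis i 1). Rng (path_quotient D T) x = X}"
    by (simp only: u(2) path_congruence.edges_quotient[OF path_congruence_reduced u(1)]
        finite_imageI)
qed

lemma source_free_reduced:
  assumes "source_free L"
  shows "source_free (reduced_kgraph L v f)"
  unfolding source_free_def is_source_def reduced_kgraph_def
    path_congruence.vertices_quotient[OF path_congruence_reduced]
proof (intro ballI notI)
  fix X assume "X \<in> (\<lambda>u. T `` {(u, [])}) ` verts (graph D)"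
  then obtain u where u: "u \<in> verts (graph D)" "X = T `` {(u, [])}" by blast
  assume "\<exists>i. {x \<in> of_degree (path_quotient D T) (axis i 1). Rng (path_quotient D T) x = X} = {}"
  then obtain i where "{e \<in> arcs (graph D). color D e = axis i 1 \<and> head (graph D) e = u} = {}"
    by (auto simp only: u(2) path_congruence.edges_quotient[OF path_congruence_reduced u(1)]
        image_is_empty)
  \<comment> \<open>In the reduced graph the edges into \<open>v\<close> become edges into \<open>w = Rng L f\<close>, and \<open>w\<close> may have lost
    its edges from \<open>v\<close>; so for \<open>w\<close> the required edge is taken among the former edges into \<open>v\<close>.\<close>
  moreover define t where "t = (if u = Rng L f then v else u)"
  have "t \<in> vertices L" "t \<noteq> Rng L f" using u v_vertex Rng_f by (auto simp: t_def)
  then obtain e where e: "e \<in> of_degree L (axis i 1)" "Rng L e = t"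
    using assms unfolding source_free_def is_source_def by blast
  have "e \<in> edges L" using e by (auto simp: of_degree_def edgeI)
  moreover have "Src L e \<noteq> v" using edge_from_v(1)[OF \<open>e \<in> edges L\<close>] e(2) \<open>t \<noteq> Rng L f\<close> by auto
  moreover have "head (graph D) e = u" using e(2) u(1) by (auto simp: t_def)
  ultimately show False using e(1) by (auto simp: edges_from_def of_degree_def)
qed

end

theorem theorem6p5:
  fixes L :: "('m, 'k::finite) kgraph_data" and v f :: 'm
  assumes "kgraph L" and "row_finite L" and "source_free L"
    and "v \<in> vertices L"
    and "complete_edge L (edges_from L v)"
    and "complete_edge L (edges_into L v)"
    and "v \<noteq> common_rng L (edges_from L v)"
    and "f \<in> edges_from L v"
  shows "path_deg (reduced_digraph L v) respects reduced_sim L v f \<and>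
    kgraph (reduced_kgraph L v f) \<and>
    row_finite (reduced_kgraph L v f) \<and>
    source_free (reduced_kgraph L v f)"
proof -
  interpret kgraph L by fact
  interpret vertex_reduction L v f by unfold_locales fact+
  have "path_deg D respects T" by (rule congruentI) (rule sim_path_deg)
  then show ?thesis
    using kgraph_reduced row_finite_reduced source_free_reduced assms(2,3) by blast
qed

end
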